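(* Let $\mathbb{F}\in\{\mathbb{R},\mathbb{C}\}$, let $N\ge2$, $M\ge2$ and $Q$ be integers with $1\le Q\le M-1$, write $\mathcal{M}=\{1,\dots,M\}$, and let $\mathbf{H}_1,\dots,\mathbf{H}_M$ be $N\times N$ positive semidefinite matrices (real symmetric if $\mathbb{F}=\mathbb{R}$, Hermitian if $\mathbb{F}=\mathbb{C}$). Take $\epsilon=0$. Let $v^{\min}_{\rm QP}$ be the optimal value of (P1): minimize $\|\mathbf{w}\|^2$ over $\mathbf{w}\in\mathbb{F}^N$, $\boldsymbol\beta\in\{0,1\}^M$ subject to $\mathbf{w}^H\mathbf{H}_i\mathbf{w}\ge\beta_i$ ($i\in\mathcal{M}$) and $\sum_i\beta_i=Q$; and let $v^{\min}_{\rm SDP2}$ be the optimal value of (SDP2): minimize $\mathrm{Tr}[\mathbf{X}]$ over $N\times N$ matrices $\mathbf{X}\succeq0$ (real symmetric if $\mathbb{F}=\mathbb{R}$, Hermitian if $\mathbb{F}=\mathbb{C}$) and $\boldsymbol\beta\in\mathbb{R}^M$ subject to $\mathrm{Tr}[\mathbf{H}_i\mathbf{X}]\ge\beta_i$ ($i\in\mathcal{M}$), $\sum_i\beta_i=Q$, $0\le\beta_i\le1$. Then $$v^{\min}_{\rm QP}\le\frac{27Q^2(M-Q+1)}{\pi}\,v^{\min}_{\rm SDP2}\quad\text{when }\mathbb{F}=\mathbb{R},$$ and $$v^{\min}_{\rm QP}\le\max\{8Q,\ 24(\sqrt{Q}-1)^2\}\,(M-Q+1)\,v^{\min}_{\rm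 SDP2}\quad\text{when }\mathbb{F}=\mathbb{C}.$$
   Context: ${}^H$ denotes conjugate transpose (ordinary transpose in the real case). *)

theory Defs
  imports "HOL-Analysis.Analysis"
begin

definition psd_real :: "real^'n^'n \<Rightarrow> bool" where
  "psd_real A \<longleftrightarrow> transpose A = A \<and> (\<forall>x. x \<bullet> (A *v x) \<ge> 0)"

definition cform :: "complex^'n^'n \<Rightarrow> complex^'n \<Rightarrow> complex" where
  "cform A w = (\<Sum>i\<in>UNIV. \<Sum>j\<in>UNIV. cnj (w $ i) * A $ i $ j * w $ j)"

definition hermitian :: "complex^'n^'n \<Rightarrow> bool" where
  "hermitian A \<longleftrightarrow> (\<forall>i j. A $ i $ j = cnj (A $ j $ i))"

definition psd_complex :: "complex^'n^'n \<Rightarrow> bool" where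
  "psd_complex A \<longleftrightarrow> hermitian A \<and> (\<forall>x. Im (cform A x) = 0 \<and> Re (cform A x) \<ge> 0)"

section \<open>Optimal values (infima in the extended reals; +\<infinity> if infeasible)\<close>

definition vQP_real :: "nat \<Rightarrow> nat \<Rightarrow> (nat \<Rightarrow> real^'n^'n) \<Rightarrow> ereal" where
  "vQP_real M Q H = Inf { ereal ((norm w)^2) | w \<beta>.
      (\<forall>i\<in>{1..M}. \<beta> i \<in> {0,1} \<and> w \<bullet> (H i *v w) \<ge> \<beta> i) \<and> (\<Sum>i=1..M. \<beta> i) = real Q }"

definition vSDP2_real :: "nat \<Rightarrow> nat \<Rightarrow> (nat \<Rightarrow> real^'n^'n) \<Rightarrow> ereal" where
  "vSDP2_real M Q H = Inf { ereal (trace X) | X \<beta>. psd_real X \<and>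
      (\<forall>i\<in>{1..M}. 0 \<le> \<beta> i \<and> \<beta> i \<le> 1 \<and> trace (H i ** X) \<ge> \<beta> i) \<and> (\<Sum>i=1..M. \<beta> i) = real Q }"

definition vQP_complex :: "nat \<Rightarrow> nat \<Rightarrow> (nat \<Rightarrow> complex^'n^'n) \<Rightarrow> ereal" where
  "vQP_complex M Q H = Inf { ereal ((norm w)^2) | w \<beta>.
      (\<forall>i\<in>{1..M}. \<beta> i \<in> {0,1} \<and> Re (cform (H i) w) \<ge> \<beta> i) \<and> (\<Sum>i=1..M. \<beta> i) = real Q }"

definition vSDP2_complex :: "nat \<Rightarrow> nat \<Rightarrow> (nat \<Rightarrow> complex^'n^'n) \<Rightarrow> ereal" where
  "vSDP2_complex M Q H = Inf { ereal (Re (trace X)) | X \<beta>. psd_complex X \<and>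
      (\<forall>i\<in>{1..M}. 0 \<le> \<beta> i \<and> \<beta> i \<le> 1 \<and> Re (trace (H i ** X)) \<ge> \<beta> i) \<and> (\<Sum>i=1..M. \<beta> i) = real Q }"

end

theory Submission
  imports Defs "HOL-Probability.Probability"
begin

text \<open>
  Factor \<open>X = U U\<^sup>H\<close> and \<open>H\<^sub>i = V\<^sub>i V\<^sub>i\<^sup>H\<close>, and put \<open>A\<^sub>i = V\<^sub>i\<^sup>H U\<close> and \<open>w = U x\<close>. Then
  \<open>w\<^sup>H H\<^sub>i w = |A\<^sub>i x|\<^sup>2\<close>, while \<open>Tr(H\<^sub>i X) = |A\<^sub>i|\<^sup>2\<close> and \<open>Tr(X) = |U|\<^sup>2\<close> are squared Frobenius
  norms. Let \<open>x\<close> be standard Gaussian and let \<open>d\<close> be the real dimension of the scalar field. Then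
  \<open>E |U x|\<^sup>2 = d |U|\<^sup>2\<close>, and \<open>E exp (- t |A\<^sub>i x|\<^sup>2 / |A\<^sub>i|\<^sup>2) \<le> (1 + 2 t)\<^bsup>-d/2\<^esup>\<close>, with equality if
  \<open>A\<^sub>i\<close> has a single row; convexity of \<open>exp\<close> reduces the general case to this one.

  If every \<open>x\<close> had some \<open>i\<close> with \<open>t |A\<^sub>i x|\<^sup>2 / |A\<^sub>i|\<^sup>2 \<le> |U x|\<^sup>2 / (c d |U|\<^sup>2)\<close>, then
  \<open>exp (-y) \<ge> 1 - y\<close> would give \<open>1 \<le> \<Sum>\<^sub>i exp (- t |A\<^sub>i x|\<^sup>2 / |A\<^sub>i|\<^sup>2) + |U x|\<^sup>2 / (c d |U|\<^sup>2)\<close>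
  everywhere, which contradicts the expectations as soon as \<open>Q (1 + 2 t)\<^bsup>-d/2\<^esup> + 1 / c < 1\<close>.

  Since the \<open>\<beta>\<^sub>i \<le> 1\<close> sum to \<open>Q\<close>, at least \<open>Q\<close> of them are \<open>\<ge> 1 / (M - Q + 1)\<close>; rescaling a good
  \<open>w\<close> for these indices bounds the ratio of the optimal values by \<open>d c t (M - Q + 1)\<close>. Over the
  reals \<open>c = 3\<close> and \<open>t = 9/8 Q\<^sup>2\<close> give \<open>d c t = 27/8 Q\<^sup>2\<close>; over the complex numbers \<open>c = 2\<close> and
  \<open>t = Q\<close> give \<open>d c t = 4 Q\<close>.
\<close>

section \<open>Conjugation in the scalar field\<close>

text \<open>The sort \<open>{real_normed_field, euclidean_space}\<close> plays the role of \<open>\<real>\<close> or \<open>\<complex>\<close>: the real inner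
  product of two scalars or vectors is the real part of the Hermitian one, so \<open>z \<bullet> 1\<close> stands for
  \<open>Re z\<close>.\<close>

definition conjugate :: "'a::{real_normed_field,euclidean_space} \<Rightarrow> 'a" where
  "conjugate a = (norm a)\<^sup>2 *\<^sub>R inverse a"

lemma conjugate_real [simp]: "conjugate (a::real) = a"
  by (cases "a = 0") (simp_all add: conjugate_def power2_eq_square)

lemma conjugate_complex [simp]: "conjugate a = cnj a"
proof (cases "a = 0")
  case False
  then show ?thesis
    using complex_norm_square[of a] by (simp add: conjugate_def scaleR_conv_of_real field_simps)
qed (simp add: conjugate_def)

lemma conjugate_mult_self: "conjugate a * a = of_real ((norm a)\<^sup>2)"
  by (cases "a = 0") (simp_all add: conjugate_def scaleR_conv_of_real)

lemma norm_conjugate [simp]: "norm (conjugate a) = norm a"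
  by (cases "a = 0") (simp_all add: conjugate_def norm_inverse power2_eq_square)

lemma conjugate_mult: "conjugate (a * b) = conjugate a * conjugate b"
  by (simp add: conjugate_def norm_mult power_mult_distrib mult.commute)

lemma conjugate_conjugate [simp]: "conjugate (conjugate a) = a"
proof (cases "a = 0")
  case False
  have "conjugate (conjugate a) * conjugate a = a * conjugate a"
    using conjugate_mult_self[of "conjugate a"] conjugate_mult_self[of a] by (simp add: mult.commute)
  moreover have "conjugate a \<noteq> 0" using False by (simp add: conjugate_def)
  ultimately show ?thesis by simp
qed (simp add: conjugate_def)

lemma inner_mult_mult:
  fixes a x y :: "'a::{real_normed_field,euclidean_space}"
  shows "(a * x) \<bullet> (a * y) = (norm a)\<^sup>2 * (x \<bullet> y)"
  unfolding dot_norm distrib_left[symmetric] norm_mult power_mult_distrib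
  by (simp add: right_diff_distrib distrib_left)

lemma inner_mult_eq_inner_conjugate:
  fixes a x y :: "'a::{real_normed_field,euclidean_space}"
  shows "(a * x) \<bullet> y = x \<bullet> (conjugate a * y)"
proof (cases "a = 0")
  case False
  then have "(a * x) \<bullet> y = (a * x) \<bullet> (a * (inverse a * y))"
    by (simp add: mult.assoc[symmetric])
  also have "\<dots> = x \<bullet> (conjugate a * y)"
    by (simp only: inner_mult_mult) (simp add: conjugate_def)
  finally show ?thesis .
qed (simp add: conjugate_def)

lemma linear_conjugate: "linear conjugate"
proof -
  have inner: "z \<bullet> conjugate a = (a * z) \<bullet> 1" for a z :: 'a
    by (simp add: inner_mult_eq_inner_conjugate)
  show ?thesis
    by (intro linearI; rule vector_eq_ldot[THEN iffD1])
      (simp_all add: inner inner_add_right inner_add_left distrib_right)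
qed

lemmas conjugate_diff = linear_diff[OF linear_conjugate]
  and conjugate_sum = linear_sum[OF linear_conjugate]

lemma conjugate_of_real [simp]: "conjugate (of_real r) = of_real r"
  by (cases "r = 0") (simp_all add: conjugate_def power2_eq_square scaleR_conv_of_real)

lemma conjugate_divide: "conjugate (a / b) = conjugate a / conjugate b"
  unfolding divide_inverse conjugate_mult
  by (simp add: conjugate_def norm_inverse power_inverse scaleR_conv_of_real)

lemma conjugate_eq_self_imp_of_real:
  assumes "conjugate a = a"
  shows "a = of_real (a \<bullet> 1)"
proof -
  have "(a - of_real (norm a)) * (a + of_real (norm a)) = 0"
    using conjugate_mult_self[of a] assms by (simp add: algebra_simps power2_eq_square)
  then have "a = norm a *\<^sub>R 1 \<or> a = (- norm a) *\<^sub>R 1"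
    by (auto simp: scaleR_conv_of_real add_eq_0_iff2)
  then obtain r :: real where "a = r *\<^sub>R 1" by blast
  then show ?thesis
    by (simp add: of_real_def power2_norm_eq_inner[symmetric])
qed

section \<open>Positive semidefinite matrices\<close>

lemma power2_norm_vec:
  fixes x :: "'a::euclidean_space^'n"
  shows "(norm x)\<^sup>2 = (\<Sum>i\<in>UNIV. (norm (x $ i))\<^sup>2)"
  by (simp add: power2_norm_eq_inner inner_vec_def)

lemma matrix_vector_mult_axis: "(A *v axis p r) $ i = A $ i $ p * r"
  by (simp add: matrix_vector_mult_def axis_def if_distrib[of "(*) _"] cong: if_cong)

lemma linear_matrix_vector_mult:
  fixes A :: "'a::real_normed_field^'n^'m"
  shows "linear ((*v) A)"
  by (intro linearI)
    (auto simp: vec_eq_iff matrix_vector_mult_def sum.distrib distrib_left scaleR_sum_right)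

definition conj_transpose :: "'a::{real_normed_field,euclidean_space}^'n^'m \<Rightarrow> 'a^'m^'n" where
  "conj_transpose A = (\<chi> i j. conjugate (A $ j $ i))"

lemma conj_transpose_conj_transpose [simp]: "conj_transpose (conj_transpose A) = A"
  by (simp add: conj_transpose_def vec_eq_iff)

lemma conj_transpose_matrix_mult: "conj_transpose (A ** B) = conj_transpose B ** conj_transpose A"
  by (simp add: conj_transpose_def matrix_matrix_mult_def conjugate_sum conjugate_mult mult.commute)

lemma inner_matrix_vector_mult: "(A *v x) \<bullet> y = x \<bullet> (conj_transpose A *v y)"
proof -
  have "(A *v x) \<bullet> y = (\<Sum>i\<in>UNIV. \<Sum>j\<in>UNIV. x $ j \<bullet> (conjugate (A $ i $ j) * y $ i))"
    by (simp add: inner_vec_def matrix_vector_mult_def inner_sum_left inner_mult_eq_inner_conjugate)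
  also have "\<dots> = (\<Sum>j\<in>UNIV. \<Sum>i\<in>UNIV. x $ j \<bullet> (conjugate (A $ i $ j) * y $ i))"
    by (rule sum.swap)
  also have "\<dots> = x \<bullet> (conj_transpose A *v y)"
    by (simp add: inner_vec_def matrix_vector_mult_def inner_sum_right conj_transpose_def)
  finally show ?thesis .
qed

definition psd :: "'a::{real_normed_field,euclidean_space}^'n^'n \<Rightarrow> bool" where
  "psd A \<longleftrightarrow> conj_transpose A = A \<and> (\<forall>x. 0 \<le> x \<bullet> (A *v x))"

lemma psd_real_eq_psd: "psd_real = psd"
  by (simp add: fun_eq_iff psd_real_def psd_def conj_transpose_def transpose_def)

lemma Re_cform: "Re (cform A x) = x \<bullet> (A *v x)"
proof -
  have "cform A x = (\<Sum>i\<in>UNIV. cnj (x $ i) * (A *v x) $ i)"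
    by (simp add: cform_def matrix_vector_mult_def sum_distrib_left mult.assoc)
  then show ?thesis
    by (simp only: inner_vec_def inner_complex_def Re_sum) simp
qed

lemma hermitian_iff_conj_transpose: "hermitian A \<longleftrightarrow> conj_transpose A = A"
  unfolding hermitian_def conj_transpose_def vec_eq_iff by (simp add: eq_commute)

lemma Im_cform_hermitian:
  assumes "hermitian A"
  shows "Im (cform A x) = 0"
proof -
  have "cnj (A $ i $ j) = A $ j $ i" for i j
    using assms by (simp add: hermitian_iff_conj_transpose conj_transpose_def vec_eq_iff)
  then have "cnj (cform A x) = (\<Sum>i\<in>UNIV. \<Sum>j\<in>UNIV. cnj (x $ j) * A $ j $ i * x $ i)"
    by (simp add: cform_def mult_ac)
  also have "\<dots> = cform A x"
    unfolding cform_def by (rule sum.swap)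
  finally show ?thesis by (simp add: complex_eq_iff)
qed

lemma psd_complex_eq_psd: "psd_complex = psd"
  by (auto simp: fun_eq_iff psd_complex_def psd_def hermitian_iff_conj_transpose[symmetric]
      Re_cform Im_cform_hermitian)

lemma psd_conjugate: "psd A \<Longrightarrow> conjugate (A $ i $ j) = A $ j $ i"
  unfolding psd_def conj_transpose_def vec_eq_iff by simp

lemma psd_diag_nonneg:
  assumes "psd A"
  shows "0 \<le> A $ p $ p \<bullet> 1"
proof -
  have "axis p 1 \<bullet> (A *v axis p 1) = A $ p $ p \<bullet> 1"
    by (simp add: inner_axis' matrix_vector_mult_axis inner_commute)
  then show ?thesis using assms unfolding psd_def by (auto dest: spec[of _ "axis p 1"])
qed

lemma psd_diag_eq_of_real: "psd A \<Longrightarrow> A $ p $ p = of_real (A $ p $ p \<bullet> 1)"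
  using psd_conjugate conjugate_eq_self_imp_of_real by blast

lemma quadratic_nonneg_imp_discriminant_le:
  fixes a b q :: real
  assumes nonneg: "\<And>s. 0 \<le> q - 2 * s * b + s\<^sup>2 * a" and "0 \<le> a"
  shows "b\<^sup>2 \<le> a * q"
proof (cases "a = 0")
  case True
  then have "b = 0"
    using nonneg[of "(q + 1) / (2 * b)"] by (cases "b = 0") simp_all
  then show ?thesis using True by simp
next
  case False
  have "0 \<le> q - b\<^sup>2 / a"
    using nonneg[of "b / a"] False by (simp add: power2_eq_square)
  then show ?thesis using False \<open>0 \<le> a\<close> by (simp add: divide_le_eq mult.commute)
qed

lemma psd_cauchy_schwarz:
  assumes "psd A"
  shows "(y \<bullet> (A *v x))\<^sup>2 \<le> (y \<bullet> (A *v y)) * (x \<bullet> (A *v x))"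
proof (rule quadratic_nonneg_imp_discriminant_le)
  fix s :: real
  note lin = linear_matrix_vector_mult[of A]
  have "x \<bullet> (A *v y) = y \<bullet> (A *v x)"
    using assms inner_matrix_vector_mult[of A x y] by (simp add: psd_def inner_commute)
  then have "(x - s *\<^sub>R y) \<bullet> (A *v (x - s *\<^sub>R y))
      = x \<bullet> (A *v x) - 2 * s * (y \<bullet> (A *v x)) + s\<^sup>2 * (y \<bullet> (A *v y))"
    by (simp add: linear_diff[OF lin] linear_scale[OF lin] inner_diff_left inner_diff_right
        power2_eq_square algebra_simps)
  then show "0 \<le> x \<bullet> (A *v x) - 2 * s * (y \<bullet> (A *v x)) + s\<^sup>2 * (y \<bullet> (A *v y))"
    using assms unfolding psd_def by (auto dest: spec[of _ "x - s *\<^sub>R y"])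
qed (use assms in \<open>simp add: psd_def\<close>)

lemma psd_norm_matrix_vector_mult_nth_le:
  fixes A :: "'a::{real_normed_field,euclidean_space}^'n^'n"
  assumes "psd A"
  shows "(norm ((A *v x) $ p))\<^sup>2 \<le> (A $ p $ p \<bullet> 1) * (x \<bullet> (A *v x))"
proof -
  define r where "r = (A *v x) $ p"
  define e where "e = (axis p r :: 'a^'n)"
  have "(A *v e) $ p = (A $ p $ p \<bullet> 1) *\<^sub>R r"
    using psd_diag_eq_of_real[OF assms, of p]
    by (simp add: e_def matrix_vector_mult_axis scaleR_conv_of_real)
  then have "(norm r)\<^sup>2 * (norm r)\<^sup>2 \<le> (norm r)\<^sup>2 * ((A $ p $ p \<bullet> 1) * (x \<bullet> (A *v x)))"
    using psd_cauchy_schwarz[OF assms, of e x]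
    by (simp add: e_def inner_axis' r_def[symmetric] power2_norm_eq_inner[symmetric]
        power2_eq_square[of "_\<^sup>2"] mult.assoc mult.left_commute del: power_mult_numeral)
  then have "(norm r)\<^sup>2 \<le> (A $ p $ p \<bullet> 1) * (x \<bullet> (A *v x))" if "r \<noteq> 0"
    by (rule mult_left_le_imp_le) (simp add: that)
  moreover have "0 \<le> (A $ p $ p \<bullet> 1) * (x \<bullet> (A *v x))"
    using assms psd_diag_nonneg[OF assms] by (simp add: psd_def)
  ultimately show ?thesis
    unfolding r_def[symmetric] by (cases "r = 0") simp_all
qed

lemma psd_row_eq_0:
  fixes A :: "'a::{real_normed_field,euclidean_space}^'n^'n"
  assumes "psd A" "A $ p $ p = 0"
  shows "A $ p $ j = 0"
  using psd_norm_matrix_vector_mult_nth_le[OF assms(1), of "axis j 1" p] assms(2)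
  by (simp add: matrix_vector_mult_axis)

text \<open>If \<open>A $ p $ p = 0\<close>, then division by zero makes the subtracted matrix vanish, so eliminating a row
  and a column needs no case distinction.\<close>

lemma psd_schur_complement:
  fixes A :: "'a::{real_normed_field,euclidean_space}^'n^'n"
  assumes "psd A"
  shows "psd (\<chi> i j. A $ i $ j - A $ i $ p * A $ p $ j / A $ p $ p)" (is "psd ?B")
proof -
  define \<alpha> where "\<alpha> = A $ p $ p \<bullet> 1"
  have App: "A $ p $ p = of_real \<alpha>"
    unfolding \<alpha>_def by (rule psd_diag_eq_of_real[OF assms])
  have "0 \<le> x \<bullet> (?B *v x)" for x
  proof -
    define r where "r = (A *v x) $ p"
    have "(?B *v x) $ i = (A *v x) $ i - A $ i $ p * (r /\<^sub>R \<alpha>)" for i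
      by (simp add: matrix_vector_mult_def r_def left_diff_distrib sum_subtractf sum_distrib_left
          App scaleR_conv_of_real field_simps)
    moreover have "(\<Sum>i\<in>UNIV. x $ i \<bullet> (A $ i $ p * (r /\<^sub>R \<alpha>))) = (norm r)\<^sup>2 / \<alpha>"
    proof -
      have "x $ i \<bullet> (A $ i $ p * (r /\<^sub>R \<alpha>)) = (A $ p $ i * x $ i) \<bullet> r / \<alpha>" for i
        using inner_mult_eq_inner_conjugate[of "A $ p $ i" "x $ i" r] psd_conjugate[OF assms]
        by (simp add: divide_inverse)
      then show ?thesis
        by (simp add: r_def matrix_vector_mult_def inner_sum_left sum_divide_distrib power2_norm_eq_inner)
    qed
    ultimately have "x \<bullet> (?B *v x) = x \<bullet> (A *v x) - (norm r)\<^sup>2 / \<alpha>"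
      by (simp add: inner_vec_def[of x] inner_diff_right sum_subtractf)
    also have "\<dots> \<ge> 0"
      using psd_norm_matrix_vector_mult_nth_le[OF assms, of x p] psd_diag_nonneg[OF assms, of p] assms
      by (cases "\<alpha> = 0") (simp_all add: r_def \<alpha>_def psd_def divide_le_eq mult.commute)
    finally show ?thesis .
  qed
  moreover have "conj_transpose ?B = ?B"
    using psd_conjugate[OF assms]
    by (simp add: conj_transpose_def vec_eq_iff App conjugate_diff conjugate_mult conjugate_divide
        mult.commute)
  ultimately show ?thesis by (simp add: psd_def)
qed

lemma psd_cholesky_support:
  fixes A :: "'a::{real_normed_field,euclidean_space}^'n^'n"
  assumes "finite S" "psd A" "\<And>k. k \<notin> S \<Longrightarrow> A $ k $ k = 0"
  shows "\<exists>U :: 'a^'n^'n. A = U ** conj_transpose U \<and> (\<forall>i k. k \<notin> S \<longrightarrow> U $ i $ k = 0)"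
  using assms
proof (induction S arbitrary: A rule: finite_induct)
  case empty
  then have "A = 0"
    using psd_row_eq_0[OF empty.prems(1) empty.prems(2)] by (simp add: vec_eq_iff)
  then show ?case
    by (intro exI[of _ 0]) (simp add: vec_eq_iff matrix_matrix_mult_def)
next
  case (insert p S)
  note A = insert.prems(1)
  define B where "B = (\<chi> i j. A $ i $ j - A $ i $ p * A $ p $ j / A $ p $ p)"
  have "B $ k $ k = 0" if "k \<notin> S" for k
    using insert.prems(2)[of k] psd_row_eq_0[OF A, of k p] that
    by (cases "k = p") (simp_all add: B_def)
  then obtain W where W: "B = W ** conj_transpose W" "\<And>i k. k \<notin> S \<Longrightarrow> W $ i $ k = 0"
    using insert.IH[OF psd_schur_complement[OF A, of p, folded B_def]] by blast
  define s where "s = sqrt (A $ p $ p \<bullet> 1)"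
  have s: "A $ p $ p = of_real s * of_real s"
    unfolding of_real_mult[symmetric] s_def real_sqrt_mult_self
      abs_of_nonneg[OF psd_diag_nonneg[OF A]] by (rule psd_diag_eq_of_real[OF A])
  define U where "U = (\<chi> i k. if k = p then A $ i $ p / of_real s else W $ i $ k)"
  have "(U ** conj_transpose U) $ i $ j = A $ i $ j" for i j
  proof -
    have "U $ i $ k * conjugate (U $ j $ k) = W $ i $ k * conjugate (W $ j $ k)
        + (if k = p then A $ i $ p * A $ p $ j / A $ p $ p else 0)" for k
      using W(2)[OF insert.hyps(2)]
      by (simp add: U_def s conjugate_divide psd_conjugate[OF A])
    then have "(U ** conj_transpose U) $ i $ j = (\<Sum>k\<in>UNIV. W $ i $ k * conjugate (W $ j $ k)
        + (if k = p then A $ i $ p * A $ p $ j / A $ p $ p else 0))"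
      by (simp add: matrix_matrix_mult_def conj_transpose_def)
    also have "\<dots> = B $ i $ j + A $ i $ p * A $ p $ j / A $ p $ p"
      by (simp add: sum.distrib W(1) matrix_matrix_mult_def conj_transpose_def)
    finally show ?thesis by (simp add: B_def)
  qed
  moreover have "U $ i $ k = 0" if "k \<notin> insert p S" for i k
    using that W(2) by (simp add: U_def)
  ultimately show ?case by (intro exI[of _ U]) (simp add: vec_eq_iff)
qed

lemma psd_cholesky:
  fixes A :: "'a::{real_normed_field,euclidean_space}^'n^'n"
  assumes "psd A"
  shows "\<exists>U :: 'a^'n^'n. A = U ** conj_transpose U"
  using psd_cholesky_support[of UNIV A] assms by auto

lemma trace_mult_conj_transpose: "trace (A ** conj_transpose A) \<bullet> 1 = (norm A)\<^sup>2"
proof -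
  have "(a * conjugate a) \<bullet> 1 = (norm a)\<^sup>2" for a :: 'a
    using conjugate_mult_self[of a]
    by (simp add: mult.commute of_real_def power2_norm_eq_inner[symmetric])
  then show ?thesis
    by (simp add: trace_def matrix_matrix_mult_def conj_transpose_def power2_norm_vec inner_sum_left)
qed

lemma quadratic_form_mult_conj_transpose:
  "w \<bullet> ((V ** conj_transpose V) *v w) = (norm (conj_transpose V *v w))\<^sup>2"
  using inner_matrix_vector_mult[of V "conj_transpose V *v w" w]
  by (simp add: power2_norm_eq_inner matrix_vector_mul_assoc inner_commute)

section \<open>The standard Gaussian measure\<close>

definition std_gaussian :: "'a::euclidean_space measure" where
  "std_gaussian = distr (\<Pi>\<^sub>M b\<in>Basis. std_normal_distribution) borel (\<lambda>f. \<Sum>b\<in>Basis. f b *\<^sub>R b)"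

lemma sets_std_gaussian [simp, measurable_cong]: "sets std_gaussian = sets borel"
  by (simp add: std_gaussian_def)

lemma prob_space_std_gaussian: "prob_space (std_gaussian :: 'a::euclidean_space measure)"
  unfolding std_gaussian_def
  by (intro prob_space.prob_space_distr prob_space_PiM prob_space_normal_density) simp_all

lemma finite_measure_std_gaussian: "finite_measure std_gaussian"
  by (rule prob_space.axioms(1)[OF prob_space_std_gaussian])

lemma
  fixes f :: "'a::euclidean_space \<Rightarrow> real \<Rightarrow> 'b::{real_normed_field,banach,second_countable_topology}"
  assumes f: "\<And>b. b \<in> Basis \<Longrightarrow> integrable std_normal_distribution (f b)"
  shows integrable_std_gaussian_prod:
      "integrable std_gaussian (\<lambda>x. \<Prod>b\<in>Basis. f b (x \<bullet> b))" (is ?integrable)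
    and integral_std_gaussian_prod:
      "(\<integral>x. (\<Prod>b\<in>Basis. f b (x \<bullet> b)) \<partial>std_gaussian)
        = (\<Prod>b\<in>Basis. \<integral>t. f b t \<partial>std_normal_distribution)" (is ?integral)
proof -
  have "product_sigma_finite (\<lambda>_::'a. std_normal_distribution)"
    by (simp add: product_sigma_finite_def prob_space_imp_sigma_finite prob_space_normal_density)
  note product_integrable = product_sigma_finite.product_integrable_prod[OF this finite_Basis f]
    and product_integral = product_sigma_finite.product_integral_prod[OF this finite_Basis f]
  have [measurable]: "f b \<in> borel_measurable borel" if "b \<in> Basis" for b
    using borel_measurable_integrable[OF f[OF that]] by simp
  have coord: "(\<Prod>b\<in>Basis. f b ((\<Sum>c\<in>Basis. g c *\<^sub>R c) \<bullet> b)) = (\<Prod>b\<in>Basis. f b (g b))" for g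
    by (intro prod.cong refl) simp
  show ?integrable
    unfolding std_gaussian_def
    by (subst integrable_distr_eq) (simp_all add: coord product_integrable)
  show ?integral
    unfolding std_gaussian_def
    by (subst integral_distr) (simp_all add: coord product_integral)
qed

lemma integral_std_gaussian_cos:
  fixes u :: "'a::euclidean_space"
  shows "(\<integral>x. cos (u \<bullet> x) \<partial>std_gaussian) = exp (- (norm u)\<^sup>2 / 2)"
proof -
  have iexp: "iexp (u \<bullet> x) = (\<Prod>b\<in>Basis. iexp ((u \<bullet> b) * (x \<bullet> b)))" for x
    by (subst euclidean_inner) (simp add: exp_sum[symmetric] sum_distrib_left)
  have int: "integrable std_normal_distribution (\<lambda>t. iexp ((u \<bullet> b) * t))" for b
    by (rule prob_space.integrable_iexp) (simp_all add: prob_space_normal_density)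
  have "(CLINT x|std_gaussian. iexp (u \<bullet> x)) = (\<Prod>b\<in>Basis. char std_normal_distribution (u \<bullet> b))"
    unfolding iexp char_def by (rule integral_std_gaussian_prod[OF int])
  also have "\<dots> = of_real (exp (- (norm u)\<^sup>2 / 2))"
    unfolding power2_norm_eq_inner[of u] euclidean_inner[of u u]
    by (simp add: char_std_normal_distribution of_real_prod[symmetric] exp_sum[symmetric]
        sum_negf sum_divide_distrib power2_eq_square del: of_real_prod)
  finally have "Re (CLINT x|std_gaussian. iexp (u \<bullet> x)) = exp (- (norm u)\<^sup>2 / 2)" by simp
  moreover have "integrable std_gaussian (\<lambda>x. iexp (u \<bullet> x))"
    unfolding iexp by (rule integrable_std_gaussian_prod[OF int])
  ultimately show ?thesis by (simp add: integral_Re[symmetric] cis_conv_exp[symmetric])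
qed

lemma
  fixes b c :: "'a::euclidean_space"
  assumes "b \<in> Basis" "c \<in> Basis"
  shows integrable_std_gaussian_coord_mult: "integrable std_gaussian (\<lambda>x. (x \<bullet> b) * (x \<bullet> c))"
    and integral_std_gaussian_coord_mult:
      "(\<integral>x. (x \<bullet> b) * (x \<bullet> c) \<partial>std_gaussian) = (if b = c then 1 else 0)"
proof -
  define k where "k d = (if d = b then 1 else 0) + (if d = c then 1 else (0::nat))" for d
  have int: "integrable std_normal_distribution (\<lambda>t. t ^ k d)" for d
    by (rule integrable_std_normal_distribution_moment)
  have prod: "(x \<bullet> b) * (x \<bullet> c) = (\<Prod>d\<in>Basis. (x \<bullet> d) ^ k d)" for x
    using assms by (simp add: k_def power_add prod.distrib if_distrib[of "(^) _"] cong: if_cong)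
  show "integrable std_gaussian (\<lambda>x. (x \<bullet> b) * (x \<bullet> c))"
    unfolding prod by (rule integrable_std_gaussian_prod[OF int])
  have moment: "(\<integral>t. t ^ k d \<partial>std_normal_distribution) = (if (d = b) = (d = c) then 1 else 0)" for d
    using std_normal_distribution_even_moments(1)[of 0] std_normal_distribution_even_moments(1)[of 1]
      integral_std_normal_distribution_moment_odd[of 1]
    by (simp add: k_def del: One_nat_def)
  show "(\<integral>x. (x \<bullet> b) * (x \<bullet> c) \<partial>std_gaussian) = (if b = c then 1 else 0)"
    unfolding prod integral_std_gaussian_prod[OF int] moment using assms by (auto intro: prod_zero)
qed

lemma
  fixes u :: "'a::euclidean_space"
  shows integrable_std_gaussian_inner_power2: "integrable std_gaussian (\<lambda>x. (u \<bullet> x)\<^sup>2)"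
    and integral_std_gaussian_inner_power2: "(\<integral>x. (u \<bullet> x)\<^sup>2 \<partial>std_gaussian) = (norm u)\<^sup>2"
proof -
  have sq: "(u \<bullet> x)\<^sup>2 = (\<Sum>b\<in>Basis. \<Sum>c\<in>Basis. (u \<bullet> b) * (u \<bullet> c) * ((x \<bullet> b) * (x \<bullet> c)))" for x
    unfolding power2_eq_square euclidean_inner[of u x] sum_product by (simp add: mult_ac)
  note coord = integrable_std_gaussian_coord_mult integral_std_gaussian_coord_mult
  show "integrable std_gaussian (\<lambda>x. (u \<bullet> x)\<^sup>2)"
    unfolding sq by (intro Bochner_Integration.integrable_sum integrable_mult_right coord)
  show "(\<integral>x. (u \<bullet> x)\<^sup>2 \<partial>std_gaussian) = (norm u)\<^sup>2"
    unfolding sq power2_norm_eq_inner euclidean_inner[of u u]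
    by (simp add: coord Bochner_Integration.integral_sum Bochner_Integration.integrable_sum
        if_distrib[of "(*) _"] cong: if_cong)
qed

lemma
  fixes L :: "'a::euclidean_space \<Rightarrow> 'b::euclidean_space"
  assumes "linear L"
  shows integrable_std_gaussian_linear_norm: "integrable std_gaussian (\<lambda>x. (norm (L x))\<^sup>2)"
    and integral_std_gaussian_linear_norm:
      "(\<integral>x. (norm (L x))\<^sup>2 \<partial>std_gaussian) = (\<Sum>e\<in>Basis. (norm (adjoint L e))\<^sup>2)"
proof -
  have norm: "(norm (L x))\<^sup>2 = (\<Sum>e\<in>Basis. (adjoint L e \<bullet> x)\<^sup>2)" for x
    unfolding power2_norm_eq_inner euclidean_inner[of "L x" "L x"]
    by (simp add: adjoint_works[OF assms] inner_commute[of "adjoint L _"] power2_eq_square)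
  note inner = integrable_std_gaussian_inner_power2 integral_std_gaussian_inner_power2
  show "integrable std_gaussian (\<lambda>x. (norm (L x))\<^sup>2)"
    and "(\<integral>x. (norm (L x))\<^sup>2 \<partial>std_gaussian) = (\<Sum>e\<in>Basis. (norm (adjoint L e))\<^sup>2)"
    unfolding norm by (simp_all add: inner Bochner_Integration.integral_sum)
qed

lemma
  assumes "0 \<le> t"
  shows integrable_std_normal_exp_square:
      "integrable std_normal_distribution (\<lambda>y. exp (- (t * y\<^sup>2)))" (is ?integrable)
    and integral_std_normal_exp_square:
      "(\<integral>y. exp (- (t * y\<^sup>2)) \<partial>std_normal_distribution) = 1 / sqrt (1 + 2 * t)" (is ?integral)
proof -
  define \<sigma> where "\<sigma> = 1 / sqrt (1 + 2 * t)"
  have \<sigma>: "\<sigma> > 0" "\<sigma>\<^sup>2 = 1 / (1 + 2 * t)" using assms by (simp_all add: \<sigma>_def power_divide)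
  have density: "std_normal_density y * exp (- (t * y\<^sup>2)) = \<sigma> * normal_density 0 \<sigma> y" for y
    unfolding normal_density_def \<sigma>(2) using assms \<sigma>(1)
    by (simp add: \<sigma>_def real_sqrt_mult real_sqrt_divide exp_add[symmetric] field_simps)
  show ?integrable
    using \<sigma>(1) by (simp add: integrable_density normal_density_nonneg density)
  show ?integral
    using \<sigma>(1) by (simp add: integral_density normal_density_nonneg density) (simp add: \<sigma>_def)
qed

lemma integral_std_gaussian_exp_norm:
  assumes "0 \<le> t"
  shows "(\<integral>x. exp (- (t * (norm x)\<^sup>2)) \<partial>(std_gaussian :: 'a::euclidean_space measure))
    = 1 / sqrt (1 + 2 * t) ^ DIM('a)"
proof -
  have "exp (- (t * (norm x)\<^sup>2)) = (\<Prod>b\<in>Basis. exp (- (t * (x \<bullet> b)\<^sup>2)))" for x :: 'a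
    unfolding power2_norm_eq_inner euclidean_inner[of x x]
    by (simp add: exp_sum[symmetric] sum_distrib_left sum_negf power2_eq_square)
  then show ?thesis
    using integral_std_gaussian_prod[where 'a='a, OF integrable_std_normal_exp_square[OF assms]]
    by (simp add: integral_std_normal_exp_square[OF assms] power_one_over)
qed

lemma borel_measurable_linear:
  fixes L :: "'a::euclidean_space \<Rightarrow> 'b::euclidean_space"
  assumes "linear L"
  shows "L \<in> borel_measurable borel"
  using assms
  by (intro borel_measurable_continuous_onI linear_continuous_on linear_conv_bounded_linear[THEN iffD1])

lemma integrable_std_gaussian_exp_linear:
  fixes L :: "'a::euclidean_space \<Rightarrow> 'b::euclidean_space"
  assumes "linear L" "0 \<le> t"
  shows "integrable std_gaussian (\<lambda>x. exp (- (t * (norm (L x))\<^sup>2)))"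
proof -
  note [measurable] = borel_measurable_linear[OF assms(1)]
  show ?thesis
    using assms(2)
    by (intro finite_measure.integrable_const_bound[OF finite_measure_std_gaussian, where B=1]) auto
qed

lemma integral_std_gaussian_exp_conformal:
  fixes L :: "'a::euclidean_space \<Rightarrow> 'b::euclidean_space"
  assumes "linear L" and n: "\<And>h. norm (adjoint L h) = n * norm h" and "0 \<le> t"
  shows "(\<integral>x. exp (- (t * (norm (L x))\<^sup>2)) \<partial>std_gaussian) = 1 / sqrt (1 + 2 * t * n\<^sup>2) ^ DIM('b)"
proof -
  have pair: "pair_sigma_finite (std_gaussian :: 'a measure) (std_gaussian :: 'b measure)"
    by (simp add: pair_sigma_finite_def prob_space_imp_sigma_finite prob_space_std_gaussian)
  have finite_pair: "finite_measure ((std_gaussian :: 'a measure) \<Otimes>\<^sub>M (std_gaussian :: 'b measure))"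
    by (intro finite_measure_pair_measure finite_measure_std_gaussian)
  note [measurable] = borel_measurable_linear[OF assms(1)]
  \<comment> \<open>Hubbard-Stratonovich: write the outer exponential as a Gaussian average of cosines of linear
    forms, which can be integrated over \<open>x\<close> first.\<close>
  define r where "r = sqrt (2 * t)"
  have r: "r\<^sup>2 = 2 * t" using assms(3) by (simp add: r_def)
  have "(\<integral>x. exp (- (t * (norm (L x))\<^sup>2)) \<partial>std_gaussian)
      = (\<integral>x. (\<integral>h. cos ((r *\<^sub>R L x) \<bullet> h) \<partial>std_gaussian) \<partial>std_gaussian)"
    by (simp only: integral_std_gaussian_cos norm_scaleR power_mult_distrib) (simp add: r)
  also have "\<dots> = (\<integral>h. (\<integral>x. cos ((r *\<^sub>R L x) \<bullet> h) \<partial>std_gaussian) \<partial>std_gaussian)"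
    by (intro pair_sigma_finite.Fubini_integral[OF pair, symmetric]
        finite_measure.integrable_const_bound[OF finite_pair, where B=1]) auto
  also have "\<dots> = (\<integral>h. (\<integral>x. cos ((r *\<^sub>R adjoint L h) \<bullet> x) \<partial>std_gaussian) \<partial>std_gaussian)"
    by (simp add: adjoint_works[OF assms(1)] inner_commute[of "adjoint L _"])
  also have "\<dots> = (\<integral>h. exp (- (t * n\<^sup>2 * (norm h)\<^sup>2)) \<partial>(std_gaussian :: 'b measure))"
    by (simp only: integral_std_gaussian_cos norm_scaleR power_mult_distrib n) (simp add: r mult.assoc)
  also have "\<dots> = 1 / sqrt (1 + 2 * t * n\<^sup>2) ^ DIM('b)"
    using assms(3) by (subst integral_std_gaussian_exp_norm) (simp_all add: mult.assoc)
  finally show ?thesis .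
qed

section \<open>The averaging argument\<close>

lemma linear_matrix_vector_mult_nth:
  fixes A :: "'a::real_normed_field^'n^'m"
  shows "linear (\<lambda>x. (A *v x) $ k)"
  using linear_compose[OF linear_matrix_vector_mult bounded_linear.linear[OF bounded_linear_vec_nth]]
  by (simp add: o_def)

lemma norm_adjoint_matrix_vector_mult_nth:
  fixes A :: "'a::{real_normed_field,euclidean_space}^'n^'m"
  shows "norm (adjoint (\<lambda>x. (A *v x) $ k) h) = norm (A $ k) * norm h"
proof -
  have "adjoint (\<lambda>x. (A *v x) $ k) = (\<lambda>h. conj_transpose A *v axis k h)"
    by (intro adjoint_unique allI) (simp add: inner_matrix_vector_mult[symmetric] inner_axis)
  then have "(norm (adjoint (\<lambda>x. (A *v x) $ k) h))\<^sup>2 = (norm (A $ k) * norm h)\<^sup>2"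
    by (simp add: power2_norm_vec matrix_vector_mult_axis conj_transpose_def norm_mult
        power_mult_distrib sum_distrib_right)
  then show ?thesis by (simp add: power2_eq_iff_nonneg)
qed

lemma
  fixes A :: "'a::{real_normed_field,euclidean_space}^'n^'m"
  shows integrable_std_gaussian_matrix_norm: "integrable std_gaussian (\<lambda>x. (norm (A *v x))\<^sup>2)"
    and integral_std_gaussian_matrix_norm:
      "(\<integral>x. (norm (A *v x))\<^sup>2 \<partial>std_gaussian) = DIM('a) * (norm A)\<^sup>2"
proof -
  note row = integrable_std_gaussian_linear_norm[OF linear_matrix_vector_mult_nth[of A]]
    integral_std_gaussian_linear_norm[OF linear_matrix_vector_mult_nth[of A]]
  show "integrable std_gaussian (\<lambda>x. (norm (A *v x))\<^sup>2)"
    by (rule integrable_std_gaussian_linear_norm[OF linear_matrix_vector_mult])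
  show "(\<integral>x. (norm (A *v x))\<^sup>2 \<partial>std_gaussian) = DIM('a) * (norm A)\<^sup>2"
    unfolding power2_norm_vec[of "A *v _"] power2_norm_vec[of A]
    by (simp add: row norm_adjoint_matrix_vector_mult_nth sum_distrib_left)
qed

lemma exp_neg_sum_le_weighted_sum:
  fixes p y :: "'k \<Rightarrow> real"
  assumes "finite K" "sum p K = 1" "\<And>k. k \<in> K \<Longrightarrow> 0 \<le> p k"
    and y: "\<And>k. k \<in> K \<Longrightarrow> p k = 0 \<Longrightarrow> y k = 0"
  shows "exp (- (\<Sum>k\<in>K. y k)) \<le> (\<Sum>k\<in>K. p k * exp (- (y k / p k)))"
proof -
  have "K \<noteq> {}" using assms(2) by auto
  then have "exp (\<Sum>k\<in>K. p k *\<^sub>R - (y k / p k)) \<le> (\<Sum>k\<in>K. p k * exp (- (y k / p k)))"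
    using assms(1-3) by (intro convex_on_sum[OF _ _ exp_convex]) auto
  also have "(\<Sum>k\<in>K. p k *\<^sub>R - (y k / p k)) = (\<Sum>k\<in>K. - y k)"
    using y by (intro sum.cong) auto
  finally show ?thesis by (simp add: sum_negf)
qed

lemma integral_std_gaussian_exp_matrix_le:
  fixes A :: "'a::{real_normed_field,euclidean_space}^'n^'m"
  assumes "A \<noteq> 0" "0 \<le> t"
  shows "(\<integral>x. exp (- (t * (norm (A *v x))\<^sup>2)) \<partial>std_gaussian)
    \<le> 1 / sqrt (1 + 2 * t * (norm A)\<^sup>2) ^ DIM('a)"
proof -
  define p where "p k = (norm (A $ k))\<^sup>2 / (norm A)\<^sup>2" for k
  define f where "f k x = exp (- (t / p k * (norm ((A *v x) $ k))\<^sup>2))" for k x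
  define E where "E = 1 / sqrt (1 + 2 * t * (norm A)\<^sup>2) ^ DIM('a)"
  have p: "0 \<le> p k" "(\<Sum>k\<in>UNIV. p k) = 1" for k
    using assms(1) by (simp_all add: p_def sum_divide_distrib[symmetric] power2_norm_vec[symmetric])
  have jensen: "exp (- (t * (norm (A *v x))\<^sup>2)) \<le> (\<Sum>k\<in>UNIV. p k * f k x)" for x
  proof -
    have "p k = 0 \<Longrightarrow> (A *v x) $ k = 0" for k
      using assms(1) by (simp add: p_def matrix_vector_mult_def)
    then show ?thesis
      using exp_neg_sum_le_weighted_sum[of UNIV p "\<lambda>k. t * (norm ((A *v x) $ k))\<^sup>2"] p
      by (simp add: f_def power2_norm_vec[of "A *v x"] sum_distrib_left)
  qed
  have f_integrable: "integrable std_gaussian (f k)" for k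
    unfolding f_def using p(1) assms(2)
    by (intro integrable_std_gaussian_exp_linear linear_matrix_vector_mult_nth) simp
  have f_integral: "p k * (\<integral>x. f k x \<partial>std_gaussian) = p k * E" for k
  proof (cases "p k = 0")
    case False
    have "(\<integral>x. f k x \<partial>std_gaussian) = 1 / sqrt (1 + 2 * (t / p k) * (norm (A $ k))\<^sup>2) ^ DIM('a)"
      unfolding f_def using p(1) assms(2)
      by (intro integral_std_gaussian_exp_conformal linear_matrix_vector_mult_nth
          norm_adjoint_matrix_vector_mult_nth) simp
    also have "2 * (t / p k) * (norm (A $ k))\<^sup>2 = 2 * t * (norm A)\<^sup>2"
      using False by (simp add: p_def)
    finally show ?thesis by (simp add: E_def)
  qed simp
  have "(\<integral>x. exp (- (t * (norm (A *v x))\<^sup>2)) \<partial>std_gaussian)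
      \<le> (\<integral>x. (\<Sum>k\<in>UNIV. p k * f k x) \<partial>std_gaussian)"
    using assms(2) f_integrable
    by (intro integral_mono jensen integrable_std_gaussian_exp_linear linear_matrix_vector_mult) simp_all
  also have "\<dots> = E"
    using f_integrable by (simp add: f_integral sum_distrib_right[symmetric] p(2))
  finally show ?thesis by (simp add: E_def)
qed

lemma one_le_sum_exp_neg_add:
  fixes y :: "'i \<Rightarrow> real"
  assumes "finite I" "i \<in> I" "y i \<le> z"
  shows "1 \<le> (\<Sum>i\<in>I. exp (- y i)) + z"
proof -
  have "1 - y i \<le> exp (- y i)" using exp_ge_add_one_self[of "- y i"] by simp
  also have "\<dots> \<le> (\<Sum>i\<in>I. exp (- y i))" using assms(1,2) by (intro member_le_sum) auto
  finally show ?thesis using assms(3) by simp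
qed

lemma exists_simultaneous_norm_ratio:
  fixes A :: "'i \<Rightarrow> 'a::{real_normed_field,euclidean_space}^'n^'m" and B :: "'a^'n^'k"
    and t c :: real
  assumes "finite I" and A: "\<And>i. i \<in> I \<Longrightarrow> A i \<noteq> 0" and B: "B \<noteq> 0" and t: "0 \<le> t" and c: "0 < c"
    and card: "c * real (card I) < (c - 1) * sqrt (1 + 2 * t) ^ DIM('a)"
  shows "\<exists>x. \<forall>i\<in>I. (norm (A i))\<^sup>2 * (norm (B *v x))\<^sup>2
    < DIM('a) * c * t * (norm B)\<^sup>2 * (norm (A i *v x))\<^sup>2"
proof (rule ccontr)
  assume "\<not> ?thesis"
  then have neg: "\<exists>i\<in>I. DIM('a) * c * t * (norm B)\<^sup>2 * (norm (A i *v x))\<^sup>2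
      \<le> (norm (A i))\<^sup>2 * (norm (B *v x))\<^sup>2" for x
    by (meson linorder_not_less)
  define f where "f i x = exp (- (t / (norm (A i))\<^sup>2 * (norm (A i *v x))\<^sup>2))" for i x
  define \<tau> where "\<tau> = c * (DIM('a) * (norm B)\<^sup>2)"
  define D where "D = sqrt (1 + 2 * t) ^ DIM('a)"
  have \<tau>: "\<tau> > 0" using B c by (simp add: \<tau>_def)
  have D: "D > 0" using t by (simp add: D_def)
  have ge_1: "1 \<le> (\<Sum>i\<in>I. f i x) + (norm (B *v x))\<^sup>2 / \<tau>" for x
  proof -
    obtain i where i: "i \<in> I" "t * \<tau> * (norm (A i *v x))\<^sup>2 \<le> (norm (A i))\<^sup>2 * (norm (B *v x))\<^sup>2"
      using neg[of x] by (auto simp: \<tau>_def mult_ac)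
    then have "t / (norm (A i))\<^sup>2 * (norm (A i *v x))\<^sup>2 \<le> (norm (B *v x))\<^sup>2 / \<tau>"
      using A[OF i(1)] \<tau> by (simp add: field_simps)
    then show ?thesis
      unfolding f_def by (rule one_le_sum_exp_neg_add[OF \<open>finite I\<close> i(1)])
  qed
  have f_integrable: "integrable std_gaussian (f i)" for i
    unfolding f_def using t
    by (intro integrable_std_gaussian_exp_linear linear_matrix_vector_mult) simp
  have f_integral: "(\<integral>x. f i x \<partial>std_gaussian) \<le> 1 / D" if "i \<in> I" for i
    using integral_std_gaussian_exp_matrix_le[OF A[OF that], of "t / (norm (A i))\<^sup>2"] A[OF that] t
    by (simp add: f_def D_def)
  note B_moment = integrable_std_gaussian_matrix_norm[of B] integral_std_gaussian_matrix_norm[of B]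
  have "1 \<le> (\<integral>x. (\<Sum>i\<in>I. f i x) + (norm (B *v x))\<^sup>2 / \<tau> \<partial>std_gaussian)"
    using f_integrable B_moment ge_1
    by (intro prob_space.integral_ge_const[OF prob_space_std_gaussian]) simp_all
  also have "\<dots> = (\<Sum>i\<in>I. \<integral>x. f i x \<partial>std_gaussian) + 1 / c"
    using f_integrable B_moment B c by (simp add: \<tau>_def)
  also have "\<dots> \<le> real (card I) * (1 / D) + 1 / c"
    using f_integral by (intro add_right_mono sum_bounded_above)
  finally have "(c - 1) * D \<le> c * real (card I)"
    using c D by (simp add: field_simps)
  then show False using card by (simp add: D_def)
qed

lemma psd_exists_simultaneous_bound:
  fixes H :: "'i \<Rightarrow> 'a::{real_normed_field,euclidean_space}^'n^'n" and t c :: real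
  assumes "finite I" "I \<noteq> {}" and H: "\<And>i. i \<in> I \<Longrightarrow> psd (H i)" and X: "psd X"
    and pos: "\<And>i. i \<in> I \<Longrightarrow> 0 < trace (H i ** X) \<bullet> 1"
    and "0 \<le> t" "0 < c" "c * real (card I) < (c - 1) * sqrt (1 + 2 * t) ^ DIM('a)"
  shows "\<exists>w. \<forall>i\<in>I. (trace (H i ** X) \<bullet> 1) * (norm w)\<^sup>2
    < DIM('a) * c * t * (trace X \<bullet> 1) * (w \<bullet> (H i *v w))"
proof -
  obtain U :: "'a^'n^'n" where U: "X = U ** conj_transpose U" using psd_cholesky[OF X] by blast
  have "\<forall>i\<in>I. \<exists>V :: 'a^'n^'n. H i = V ** conj_transpose V" using psd_cholesky H by blast
  then obtain V :: "'i \<Rightarrow> 'a^'n^'n" where V: "\<And>i. i \<in> I \<Longrightarrow> H i = V i ** conj_transpose (V i)"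
    by metis
  define A where "A i = conj_transpose (V i) ** U" for i
  have trace: "trace (H i ** X) \<bullet> 1 = (norm (A i))\<^sup>2" if "i \<in> I" for i
  proof -
    have "trace (H i ** X) = trace (V i ** (conj_transpose (V i) ** U ** conj_transpose U))"
      unfolding V[OF that] U by (simp only: matrix_mul_assoc)
    also have "\<dots> = trace (conj_transpose (V i) ** U ** conj_transpose U ** V i)"
      by (rule trace_mul_sym)
    also have "\<dots> = trace (A i ** conj_transpose (A i))"
      by (simp only: A_def conj_transpose_matrix_mult conj_transpose_conj_transpose matrix_mul_assoc)
    finally show ?thesis by (simp add: trace_mult_conj_transpose)
  qed
  have trace_X: "trace X \<bullet> 1 = (norm U)\<^sup>2" by (simp add: U trace_mult_conj_transpose)
  have A: "A i \<noteq> 0" if "i \<in> I" for i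
    using pos[OF that] trace[OF that] by auto
  then have "U \<noteq> 0"
    using \<open>I \<noteq> {}\<close> by (auto simp: A_def matrix_matrix_mult_def vec_eq_iff)
  then obtain x where x: "\<And>i. i \<in> I \<Longrightarrow> (norm (A i))\<^sup>2 * (norm (U *v x))\<^sup>2
      < DIM('a) * c * t * (norm U)\<^sup>2 * (norm (A i *v x))\<^sup>2"
    using exists_simultaneous_norm_ratio[of I A U t c] A assms by blast
  have "(U *v x) \<bullet> (H i *v (U *v x)) = (norm (A i *v x))\<^sup>2" if "i \<in> I" for i
    unfolding V[OF that] quadratic_form_mult_conj_transpose
    by (simp add: A_def matrix_vector_mul_assoc)
  then show ?thesis
    using x by (intro exI[of _ "U *v x"]) (simp add: trace trace_X)
qed

section \<open>Rounding\<close>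

lemma exists_large_entries:
  fixes \<beta> :: "'i \<Rightarrow> real"
  assumes "finite S" "Q \<le> card S" and \<beta>: "\<And>i. i \<in> S \<Longrightarrow> \<beta> i \<le> 1" and sum: "sum \<beta> S = real Q"
  shows "\<exists>I\<subseteq>S. card I = Q \<and> (\<forall>i\<in>I. 1 / real (card S - Q + 1) \<le> \<beta> i)"
proof -
  define m where "m = real (card S - Q + 1)"
  have m: "m \<ge> 1" "m = real (card S) - real Q + 1" using assms(2) by (auto simp: m_def of_nat_diff)
  define G where "G = {i \<in> S. 1 / m \<le> \<beta> i}"
  have G: "G \<subseteq> S" "finite G" using \<open>finite S\<close> by (auto simp: G_def)
  have "Q \<le> card G"
  proof (rule ccontr)
    assume less: "\<not> Q \<le> card G"
    then obtain j where "j \<in> S - G"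
      using card_mono[OF G(2), of S] assms(2) by fastforce
    have "sum \<beta> S < (\<Sum>i\<in>S. 1 / m + (if i \<in> G then 1 - 1 / m else 0))"
      using \<open>finite S\<close> \<open>j \<in> S - G\<close> \<beta>
      by (intro sum_strict_mono_ex1 bexI[of _ j]) (auto simp: G_def not_le)
    also have "\<dots> = real (card S) / m + real (card G) * (1 - 1 / m)"
      using \<open>finite S\<close> G by (simp add: sum.distrib sum.If_cases Int_absorb1)
    also have "\<dots> \<le> real (card S) / m + (real Q - 1) * (1 - 1 / m)"
      using less m(1) by (intro add_left_mono mult_right_mono) auto
    also have "\<dots> = real Q"
      using m by (simp add: field_simps)
    finally show False using sum by simp
  qed
  then obtain I where "I \<subseteq> G" "card I = Q"
    using obtain_subset_with_card_n by blast
  then show ?thesis using G by (intro exI[of _ I]) (auto simp: G_def m_def)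
qed

definition vQP :: "nat \<Rightarrow> nat \<Rightarrow> (nat \<Rightarrow> 'a::{real_normed_field,euclidean_space}^'n^'n) \<Rightarrow> ereal" where
  "vQP M Q H = Inf {ereal ((norm w)\<^sup>2) | w \<beta>.
      (\<forall>i\<in>{1..M}. \<beta> i \<in> {0,1} \<and> w \<bullet> (H i *v w) \<ge> \<beta> i) \<and> (\<Sum>i=1..M. \<beta> i) = real Q}"

definition vSDP2 :: "nat \<Rightarrow> nat \<Rightarrow> (nat \<Rightarrow> 'a::{real_normed_field,euclidean_space}^'n^'n) \<Rightarrow> ereal" where
  "vSDP2 M Q H = Inf {ereal (trace X \<bullet> 1) | X \<beta>. psd X \<and>
      (\<forall>i\<in>{1..M}. 0 \<le> \<beta> i \<and> \<beta> i \<le> 1 \<and> trace (H i ** X) \<bullet> 1 \<ge> \<beta> i) \<and> (\<Sum>i=1..M. \<beta> i) = real Q}"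

lemma vQP_real_eq_vQP: "vQP_real = vQP"
  by (simp add: fun_eq_iff vQP_real_def vQP_def)

lemma vSDP2_real_eq_vSDP2: "vSDP2_real = vSDP2"
  by (simp add: fun_eq_iff vSDP2_real_def vSDP2_def psd_real_eq_psd)

lemma vQP_complex_eq_vQP: "vQP_complex = vQP"
  by (simp add: fun_eq_iff vQP_complex_def vQP_def Re_cform)

lemma vSDP2_complex_eq_vSDP2: "vSDP2_complex = vSDP2"
  by (simp add: fun_eq_iff vSDP2_complex_def vSDP2_def psd_complex_eq_psd)

lemma psd_trace_nonneg:
  assumes "psd X"
  shows "0 \<le> trace X \<bullet> 1"
  using psd_diag_nonneg[OF assms] by (simp add: trace_def inner_sum_left sum_nonneg)

lemma vSDP2_nonneg: "0 \<le> vSDP2 M Q H"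
  unfolding vSDP2_def by (intro Inf_greatest) (auto simp: psd_trace_nonneg)

lemma vQP_le_scaling:
  fixes H :: "nat \<Rightarrow> 'a::{real_normed_field,euclidean_space}^'n^'n"
  assumes H: "\<And>i. i \<in> {1..M} \<Longrightarrow> psd (H i)" and "0 \<le> K"
    and I: "I \<subseteq> {1..M}" "I \<noteq> {}"
    and w: "\<And>i. i \<in> I \<Longrightarrow> (norm w)\<^sup>2 < K * (w \<bullet> (H i *v w))"
  shows "vQP M (card I) H \<le> ereal K"
proof -
  have "w \<noteq> 0" using I w by fastforce
  define r where "r = sqrt K / norm w"
  have r: "r\<^sup>2 = K / (norm w)\<^sup>2" using \<open>0 \<le> K\<close> by (simp add: r_def power_divide)
  define \<beta> where "\<beta> i = (if i \<in> I then 1 else 0 :: real)" for i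
  have form: "(r *\<^sub>R w) \<bullet> (H i *v (r *\<^sub>R w)) = r\<^sup>2 * (w \<bullet> (H i *v w))" for i
    by (simp add: linear_scale[OF linear_matrix_vector_mult] power2_eq_square)
  have "\<beta> i \<in> {0,1} \<and> (r *\<^sub>R w) \<bullet> (H i *v (r *\<^sub>R w)) \<ge> \<beta> i" if "i \<in> {1..M}" for i
    unfolding form r using that H[OF that] w[of i] \<open>w \<noteq> 0\<close> \<open>0 \<le> K\<close>
    by (auto simp: \<beta>_def psd_def field_simps)
  moreover have "(\<Sum>i=1..M. \<beta> i) = real (card I)"
    using I by (simp add: \<beta>_def sum.If_cases Int_absorb1)
  ultimately have "vQP M (card I) H \<le> ereal ((norm (r *\<^sub>R w))\<^sup>2)"
    unfolding vQP_def by (intro Inf_lower) blast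
  also have "(norm (r *\<^sub>R w))\<^sup>2 = K"
    using \<open>w \<noteq> 0\<close> by (simp add: power_mult_distrib r)
  finally show ?thesis .
qed

lemma vQP_le_trace_feasible:
  fixes H :: "nat \<Rightarrow> 'a::{real_normed_field,euclidean_space}^'n^'n" and t c :: real
  assumes Q: "1 \<le> Q" "Q \<le> M" and H: "\<And>i. i \<in> {1..M} \<Longrightarrow> psd (H i)"
    and tc: "0 < t" "0 < c" "c * real Q < (c - 1) * sqrt (1 + 2 * t) ^ DIM('a)"
    and X: "psd X" and \<beta>: "\<And>i. i \<in> {1..M} \<Longrightarrow> \<beta> i \<le> 1 \<and> \<beta> i \<le> trace (H i ** X) \<bullet> 1"
      "(\<Sum>i=1..M. \<beta> i) = real Q"
  shows "vQP M Q H \<le> ereal (DIM('a) * c * t * real (M - Q + 1) * (trace X \<bullet> 1))"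
proof -
  define m where "m = real (M - Q + 1)"
  define \<tau> where "\<tau> = DIM('a) * c * t * (trace X \<bullet> 1)"
  have "m > 0" by (simp add: m_def)
  have "\<tau> \<ge> 0" using tc psd_trace_nonneg[OF X] by (simp add: \<tau>_def)
  obtain I where I: "I \<subseteq> {1..M}" "card I = Q" "\<And>i. i \<in> I \<Longrightarrow> 1 / m \<le> \<beta> i"
    using exists_large_entries[of "{1..M}" Q \<beta>] Q \<beta> by (auto simp: m_def)
  have "finite I" "I \<noteq> {}" using I Q finite_subset by auto
  have T: "1 / m \<le> trace (H i ** X) \<bullet> 1" if "i \<in> I" for i
    using I(1) I(3)[OF that] \<beta>(1)[of i] that by force
  then have "0 < trace (H i ** X) \<bullet> 1" if "i \<in> I" for i
    using that \<open>m > 0\<close> by (meson divide_pos_pos less_le_trans zero_less_one)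
  then have "\<exists>w. \<forall>i\<in>I. (trace (H i ** X) \<bullet> 1) * (norm w)\<^sup>2 < \<tau> * (w \<bullet> (H i *v w))"
    unfolding \<tau>_def using I(1,2) H tc
    by (intro psd_exists_simultaneous_bound[OF \<open>finite I\<close> \<open>I \<noteq> {}\<close> _ X]) auto
  then obtain w where w: "\<And>i. i \<in> I \<Longrightarrow>
      (trace (H i ** X) \<bullet> 1) * (norm w)\<^sup>2 < \<tau> * (w \<bullet> (H i *v w))"
    by blast
  have "(norm w)\<^sup>2 < m * \<tau> * (w \<bullet> (H i *v w))" if "i \<in> I" for i
  proof -
    have "(norm w)\<^sup>2 / m \<le> (trace (H i ** X) \<bullet> 1) * (norm w)\<^sup>2"
      using mult_right_mono[OF T[OF that], of "(norm w)\<^sup>2"] by simp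
    also note w[OF that]
    finally show ?thesis using \<open>m > 0\<close> by (simp add: field_simps)
  qed
  then have "vQP M (card I) H \<le> ereal (m * \<tau>)"
    using H I(1) \<open>I \<noteq> {}\<close> \<open>m > 0\<close> \<open>\<tau> \<ge> 0\<close> by (intro vQP_le_scaling[where w=w]) simp_all
  then show ?thesis by (simp add: I(2) m_def \<tau>_def mult_ac)
qed

theorem vQP_le_vSDP2:
  fixes H :: "nat \<Rightarrow> 'a::{real_normed_field,euclidean_space}^'n^'n" and t c :: real
  assumes "1 \<le> Q" "Q \<le> M" "\<And>i. i \<in> {1..M} \<Longrightarrow> psd (H i)"
    and "0 < t" "0 < c" "c * real Q < (c - 1) * sqrt (1 + 2 * t) ^ DIM('a)"
  shows "vQP M Q H \<le> ereal (DIM('a) * c * t * real (M - Q + 1)) * vSDP2 M Q H"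
proof -
  define \<kappa> where "\<kappa> = DIM('a) * c * t * real (M - Q + 1)"
  have "0 < \<kappa>" using assms(4,5) by (simp add: \<kappa>_def)
  moreover have "vQP M Q H \<le> ereal (\<kappa> * (trace X \<bullet> 1))"
    if "psd X" "\<forall>i\<in>{1..M}. 0 \<le> \<beta> i \<and> \<beta> i \<le> 1 \<and> trace (H i ** X) \<bullet> 1 \<ge> \<beta> i"
      "(\<Sum>i=1..M. \<beta> i) = real Q" for X \<beta>
    unfolding \<kappa>_def using that by (intro vQP_le_trace_feasible[OF assms]) auto
  ultimately have "vQP M Q H \<le> ereal \<kappa> * vSDP2 M Q H"
    unfolding vSDP2_def by (subst ereal_Inf_cmult[symmetric]) (auto intro!: Inf_greatest)
  then show ?thesis by (simp add: \<kappa>_def)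
qed

lemma vQP_le_vSDP2_mono:
  assumes "vQP M Q H \<le> ereal C * vSDP2 M Q H" "C \<le> C'"
  shows "vQP M Q H \<le> ereal C' * vSDP2 M Q H"
  using assms by (meson ereal_less_eq(3) ereal_mult_right_mono order_trans vSDP2_nonneg)

lemma vQP_le_vSDP2_real:
  fixes H :: "nat \<Rightarrow> real^'n^'n"
  assumes "1 \<le> Q" "Q \<le> M" "\<And>i. i \<in> {1..M} \<Longrightarrow> psd (H i)"
  shows "vQP M Q H \<le> ereal (27/8 * (real Q)\<^sup>2 * real (M - Q + 1)) * vSDP2 M Q H"
proof -
  have "3 / 2 * real Q < sqrt (1 + 2 * (9/8 * (real Q)\<^sup>2))"
    by (rule real_less_rsqrt) (simp add: power_mult_distrib power_divide)
  then show ?thesis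
    using vQP_le_vSDP2[of Q M H "9/8 * (real Q)\<^sup>2" 3] assms by simp
qed

lemma vQP_le_vSDP2_complex:
  fixes H :: "nat \<Rightarrow> complex^'n^'n"
  assumes "1 \<le> Q" "Q \<le> M" "\<And>i. i \<in> {1..M} \<Longrightarrow> psd (H i)"
  shows "vQP M Q H \<le> ereal (4 * real Q * real (M - Q + 1)) * vSDP2 M Q H"
  using vQP_le_vSDP2[of Q M H "real Q" 2] assms by simp

theorem theorem2p7:
  fixes M Q :: nat
  assumes "CARD('n) \<ge> 2" and "M \<ge> 2" and "1 \<le> Q" and "Q \<le> M - 1"
  shows "(\<forall>H :: nat \<Rightarrow> real^'n^'n. (\<forall>i\<in>{1..M}. psd_real (H i)) \<longrightarrow>
            vQP_real M Q H \<le> ereal (27 * real Q ^ 2 * real (M - Q + 1) / pi) * vSDP2_real M Q H)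
       \<and> (\<forall>H :: nat \<Rightarrow> complex^'n^'n. (\<forall>i\<in>{1..M}. psd_complex (H i)) \<longrightarrow>
            vQP_complex M Q H \<le> ereal (max (8 * real Q) (24 * (sqrt (real Q) - 1)^2) * real (M - Q + 1))
                                    * vSDP2_complex M Q H)"
  unfolding psd_real_eq_psd psd_complex_eq_psd vQP_real_eq_vQP vSDP2_real_eq_vSDP2
    vQP_complex_eq_vQP vSDP2_complex_eq_vSDP2
proof (intro conjI allI impI)
  have Q: "1 \<le> Q" "Q \<le> M" using assms by simp_all
  have real_constant: "27/8 * (real Q)\<^sup>2 * real (M - Q + 1) \<le> 27 * real Q ^ 2 * real (M - Q + 1) / pi"
    using mult_left_mono[of pi 8 "27/8 * (real Q)\<^sup>2 * real (M - Q + 1)"] pi_less_4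
    by (simp add: pos_le_divide_eq)
  show "vQP M Q H \<le> ereal (27 * real Q ^ 2 * real (M - Q + 1) / pi) * vSDP2 M Q H"
    if "\<forall>i\<in>{1..M}. psd (H i)" for H :: "nat \<Rightarrow> real^'n^'n"
    using that by (intro vQP_le_vSDP2_mono[OF vQP_le_vSDP2_real[OF Q] real_constant]) blast
  have complex_constant: "4 * real Q * real (M - Q + 1)
      \<le> max (8 * real Q) (24 * (sqrt (real Q) - 1)^2) * real (M - Q + 1)"
    by (intro mult_right_mono max.coboundedI1) simp_all
  show "vQP M Q H
      \<le> ereal (max (8 * real Q) (24 * (sqrt (real Q) - 1)^2) * real (M - Q + 1)) * vSDP2 M Q H"
    if "\<forall>i\<in>{1..M}. psd (H i)" for H :: "nat \<Rightarrow> complex^'n^'n"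
    using that by (intro vQP_le_vSDP2_mono[OF vQP_le_vSDP2_complex[OF Q] complex_constant]) blast
qed

end
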